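(* Let $\langle v_i\rangle_{i\ge1}$ and $\langle\pi_i\rangle_{i\ge0}$ be the sequences generated by DPI or by IPI, starting from an admissible policy $\pi_0$ and under the boundary condition that, for every $i\in\mathbb N$, if $\pi_{i-1}$ is admissible then $\lim_{t\to\infty}\mathbb G_{\pi_{i-1}}^x[\gamma^tv_i(X_t)]=0$ for all $x\in\mathcal X$. Then for all $i\in\mathbb N$, $\pi_{i-1}$ is admissible and $v_i=v_{\pi_{i-1}}$. Moreover, the policies are monotonically improved: $$\pi_0\preccurlyeq\pi_1\preccurlyeq\cdots\preccurlyeq\pi_{i-1}\preccurlyeq\pi_i\preccurlyeq\cdots.$$
   Context: State space $\mathcal X=\mathbb R^l$, $\mathcal X^{\mathsf T}=\mathbb R^{1\times l}$, time space $\mathbb T=[0,\infty)$. The action space $\mathcal U\subseteq\mathbb R^m$ is an $m$-dimensional manifold with or without boundary, meaning $\mathcal U=O\cup\partial O$ or $\mathcal U=O$ for some open $O\subseteq\mathbb R^m$. The environment is $\dot X_t=f(X_t,U_t)$, with $f:\mathcal X\times\mathcal U\to\mathcal X$ continuous and $t\mapsto U_t\in\mathcal U$ continuous; it is a standing assumption that the state trajectory $t\mapsto X_t$ is uniquely defined over all of $\mathbb T$ (for every initial state, in particular under every policy). A policy is a continuous function $\pi:\mathcal X\to\mathcal U$. $\mathbb G_\pi^x[Y]$ denotes the value of $Y$ when $X_0=x$ and $U_t=\pi(X_t)$ for all $t\in\mathbb T$. The reward function $r:\mathcal X\times\mathcal U\to\mathbb R$ is continuous, $R_t=r(X_t,U_t)$;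 $\gamma\in(0,1]$ is the discount factor and $\alpha=-\ln\gamma\ge0$. Standing assumption: $r$ attains a maximum $r_{\mathsf{max}}$, and $r_{\mathsf{max}}=0$ if $\gamma=1$. The value function (VF) of $\pi$ is $v_\pi(x)=\mathbb G_\pi^x[\int_0^\infty\gamma^tR_t\,dt]\in[-\infty,\infty)$. A policy $\pi$ is admissible iff $v_\pi(x)$ is finite for all $x\in\mathcal X$. $\pi\preccurlyeq\pi'$ means $v_\pi(x)\le v_{\pi'}(x)$ for all $x$. Standing assumption: at least one admissible policy exists, and every admissible VF is $\mathrm C^1$. Gradients are row vectors, and the Hamiltonian is $h(x,u,p)=r(x,u)+p\,f(x,u)$. Standing assumption: there is a continuous $u_*:\mathcal X\times\mathcal X^{\mathsf T}\to\mathcal U$ with $u_*(x,p)\in\arg\max_{u\in\mathcal U}h(x,u,p)$ for all $(x,p)$. DPI (differential policy iteration): given an admissible policy $\pi_0$, for $i=1,2,\dots$: (evaluation) $v_i:\mathcal X\to\mathbb R$ is a $\mathrm C^1$ function with $\alpha v_i(x)=h(x,\pi_{i-1}(x),\nabla v_i(x))$ for all $x$; (improvement) $\pi_i$ is a policy with $\pi_i(x)\in\arg\max_{u\in\mathcal U}h(x,u,\nabla v_i(x))$ for all $x$. IPI (integral policy iteration): given an admissible policy $\pi_0$ and a fixed $\eta>0$, for $i=1,2,\dots$: (evaluation) $v_i:\mathcal X\to\mathbb R$ is a $\mathrm C^1$ function with $v_i(x)=\mathbb G_{\pi_{i-1}}^x[\int_0^\eta\gamma^tR_t\,dt+\gamma^\eta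 v_i(X_\eta)]$ for all $x$; (improvement) $\pi_i$ is a policy with $\pi_i(x)\in\arg\max_{u\in\mathcal U}[r(x,u)+\nabla v_i(x)f_{\mathsf c}(x,u)]$ for all $x$, where $f(x,u)=f_{\mathsf d}(x)+f_{\mathsf c}(x,u)$ with $f_{\mathsf d},f_{\mathsf c}$ continuous (the same argmax set as for $h(x,\cdot,\nabla v_i(x))$). *)

theory Defs
  imports "HOL-Analysis.Analysis"
begin

definition manifold_with_or_without_boundary :: "'a::euclidean_space set \<Rightarrow> bool" where
  "manifold_with_or_without_boundary U \<longleftrightarrow> (\<exists>V. open V \<and> (U = V \<union> frontier V \<or> U = V))"

text \<open>A row vector is represented by an element \<open>p\<close> of \<^typ>\<open>real ^ 'l\<close>; its product with a
  column vector \<open>y\<close> is the inner product \<open>p \<bullet> y\<close>.  Outside \<open>U\<close> the values of \<open>f x\<close> and \<open>r x\<close>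
  are irrelevant.\<close>

definition grad :: "(real ^ 'l \<Rightarrow> real) \<Rightarrow> real ^ 'l \<Rightarrow> real ^ 'l" where
  "grad v x = (THE D. GDERIV v x :> D)"

definition C1 :: "(real ^ 'l \<Rightarrow> real) \<Rightarrow> bool" where
  "C1 v \<longleftrightarrow> (\<forall>x. v differentiable (at x)) \<and> continuous_on UNIV (grad v)"

definition hamiltonian ::
  "(real ^ 'l \<Rightarrow> real ^ 'm \<Rightarrow> real ^ 'l) \<Rightarrow> (real ^ 'l \<Rightarrow> real ^ 'm \<Rightarrow> real)
    \<Rightarrow> real ^ 'l \<Rightarrow> real ^ 'm \<Rightarrow> real ^ 'l \<Rightarrow> real" where
  "hamiltonian f r x u p = r x u + p \<bullet> f x u"

definition state_trajectory ::
  "(real ^ 'l \<Rightarrow> real ^ 'm \<Rightarrow> real ^ 'l) \<Rightarrow> (real \<Rightarrow> real ^ 'm) \<Rightarrow> real ^ 'l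
    \<Rightarrow> (real \<Rightarrow> real ^ 'l) \<Rightarrow> bool" where
  "state_trajectory f a x X \<longleftrightarrow>
     X 0 = x \<and> (\<forall>t\<ge>0. (X has_vector_derivative f (X t) (a t)) (at t within {0..}))"

definition closed_loop_trajectory ::
  "(real ^ 'l \<Rightarrow> real ^ 'm \<Rightarrow> real ^ 'l) \<Rightarrow> (real ^ 'l \<Rightarrow> real ^ 'm) \<Rightarrow> real ^ 'l
    \<Rightarrow> (real \<Rightarrow> real ^ 'l) \<Rightarrow> bool" where
  "closed_loop_trajectory f \<pi> x X \<longleftrightarrow> state_trajectory f (\<lambda>t. \<pi> (X t)) x X"

definition uniquely_defined :: "((real \<Rightarrow> real ^ 'l) \<Rightarrow> bool) \<Rightarrow> bool" where
  "uniquely_defined P \<longleftrightarrow> (\<exists>X. P X) \<and> (\<forall>X Y. P X \<longrightarrow> P Y \<longrightarrow> (\<forall>t\<ge>0. X t = Y t))"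

definition policy :: "(real ^ 'm) set \<Rightarrow> (real ^ 'l \<Rightarrow> real ^ 'm) \<Rightarrow> bool" where
  "policy U \<pi> \<longleftrightarrow> continuous_on UNIV \<pi> \<and> range \<pi> \<subseteq> U"

text \<open>The state at time \<open>t\<close> when the policy \<open>\<pi>\<close> is followed from \<open>x\<close>.  Under the standing
  assumptions the values at \<open>t \<ge> 0\<close>, the only ones used, do not depend on the choice.\<close>

definition state_under ::
  "(real ^ 'l \<Rightarrow> real ^ 'm \<Rightarrow> real ^ 'l) \<Rightarrow> (real ^ 'l \<Rightarrow> real ^ 'm) \<Rightarrow> real ^ 'l
    \<Rightarrow> real \<Rightarrow> real ^ 'l" where
  "state_under f \<pi> x = (SOME X. closed_loop_trajectory f \<pi> x X)"

definition discounted_reward ::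
  "(real ^ 'l \<Rightarrow> real ^ 'm \<Rightarrow> real ^ 'l) \<Rightarrow> (real ^ 'l \<Rightarrow> real ^ 'm \<Rightarrow> real) \<Rightarrow> real
    \<Rightarrow> (real ^ 'l \<Rightarrow> real ^ 'm) \<Rightarrow> real ^ 'l \<Rightarrow> real \<Rightarrow> real" where
  "discounted_reward f r \<gamma> \<pi> x T =
     integral {0..T} (\<lambda>t. \<gamma> powr t * r (state_under f \<pi> x t) (\<pi> (state_under f \<pi> x t)))"

text \<open>The improper integral over \<open>[0, \<infinity>)\<close>.  The limit exists in the extended reals under the
  standing assumptions: subtracting \<open>\<integral>\<^sub>0\<^sup>T \<gamma>\<^sup>t r\<^sub>m\<^sub>a\<^sub>x dt\<close>, which converges to a real number as
  \<open>T \<rightarrow> \<infinity>\<close>, leaves a nonincreasing function of \<open>T\<close>.\<close>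

definition value_function ::
  "(real ^ 'l \<Rightarrow> real ^ 'm \<Rightarrow> real ^ 'l) \<Rightarrow> (real ^ 'l \<Rightarrow> real ^ 'm \<Rightarrow> real) \<Rightarrow> real
    \<Rightarrow> (real ^ 'l \<Rightarrow> real ^ 'm) \<Rightarrow> real ^ 'l \<Rightarrow> ereal" where
  "value_function f r \<gamma> \<pi> x = Lim at_top (\<lambda>T. ereal (discounted_reward f r \<gamma> \<pi> x T))"

definition admissible ::
  "(real ^ 'm) set \<Rightarrow> (real ^ 'l \<Rightarrow> real ^ 'm \<Rightarrow> real ^ 'l)
    \<Rightarrow> (real ^ 'l \<Rightarrow> real ^ 'm \<Rightarrow> real) \<Rightarrow> real \<Rightarrow> (real ^ 'l \<Rightarrow> real ^ 'm) \<Rightarrow> bool" where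
  "admissible U f r \<gamma> \<pi> \<longleftrightarrow> policy U \<pi> \<and> (\<forall>x. \<bar>value_function f r \<gamma> \<pi> x\<bar> \<noteq> \<infinity>)"

definition policy_le ::
  "(real ^ 'l \<Rightarrow> real ^ 'm \<Rightarrow> real ^ 'l) \<Rightarrow> (real ^ 'l \<Rightarrow> real ^ 'm \<Rightarrow> real) \<Rightarrow> real
    \<Rightarrow> (real ^ 'l \<Rightarrow> real ^ 'm) \<Rightarrow> (real ^ 'l \<Rightarrow> real ^ 'm) \<Rightarrow> bool" where
  "policy_le f r \<gamma> \<pi> \<pi>' \<longleftrightarrow> (\<forall>x. value_function f r \<gamma> \<pi> x \<le> value_function f r \<gamma> \<pi>' x)"

locale rl_problem =
  fixes U :: "(real ^ 'm) set"
    and f :: "real ^ 'l \<Rightarrow> real ^ 'm \<Rightarrow> real ^ 'l"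
    and r :: "real ^ 'l \<Rightarrow> real ^ 'm \<Rightarrow> real"
    and \<gamma> :: real
  assumes action_space: "manifold_with_or_without_boundary U"
    and f_continuous: "continuous_on (UNIV \<times> U) (\<lambda>(x, u). f x u)"
    and trajectory_open_loop:
      "\<And>a x. continuous_on {0..} a \<Longrightarrow> a ` {0..} \<subseteq> U \<Longrightarrow> uniquely_defined (state_trajectory f a x)"
    and trajectory_closed_loop:
      "\<And>\<pi> x. policy U \<pi> \<Longrightarrow> uniquely_defined (closed_loop_trajectory f \<pi> x)"
    and r_continuous: "continuous_on (UNIV \<times> U) (\<lambda>(x, u). r x u)"
    and discount: "0 < \<gamma>" "\<gamma> \<le> 1"
    and r_max: "\<exists>r_max. (\<exists>x. \<exists>u\<in>U. r x u = r_max) \<and> (\<forall>x. \<forall>u\<in>U. r x u \<le> r_max)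
                  \<and> (\<gamma> = 1 \<longrightarrow> r_max = 0)"
    and admissible_exists: "\<exists>\<pi>. admissible U f r \<gamma> \<pi>"
    and admissible_C1:
      "\<And>\<pi>. admissible U f r \<gamma> \<pi> \<Longrightarrow> C1 (\<lambda>x. real_of_ereal (value_function f r \<gamma> \<pi> x))"
    and maximizer_exists:
      "\<exists>ustar. continuous_on UNIV (\<lambda>(x, p). ustar x p) \<and>
         (\<forall>x p. is_arg_max (\<lambda>u. hamiltonian f r x u p) (\<lambda>u. u \<in> U) (ustar x p))"

text \<open>In both schemes \<open>v\<close> is indexed from \<open>1\<close> (\<open>v 0\<close> is unconstrained) and \<open>\<pi>\<close> from \<open>0\<close>.
  The factor \<open>- ln \<gamma>\<close> is \<open>\<alpha>\<close>.\<close>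

definition DPI ::
  "(real ^ 'm) set \<Rightarrow> (real ^ 'l \<Rightarrow> real ^ 'm \<Rightarrow> real ^ 'l)
    \<Rightarrow> (real ^ 'l \<Rightarrow> real ^ 'm \<Rightarrow> real) \<Rightarrow> real
    \<Rightarrow> (nat \<Rightarrow> real ^ 'l \<Rightarrow> real ^ 'm) \<Rightarrow> (nat \<Rightarrow> real ^ 'l \<Rightarrow> real) \<Rightarrow> bool" where
  "DPI U f r \<gamma> \<pi> v \<longleftrightarrow>
     admissible U f r \<gamma> (\<pi> 0) \<and>
     (\<forall>i\<ge>1.
        C1 (v i) \<and>
        (\<forall>x. - ln \<gamma> * v i x = hamiltonian f r x (\<pi> (i - 1) x) (grad (v i) x)) \<and>
        policy U (\<pi> i) \<and>
        (\<forall>x. is_arg_max (\<lambda>u. hamiltonian f r x u (grad (v i) x)) (\<lambda>u. u \<in> U) (\<pi> i x)))"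

definition IPI ::
  "(real ^ 'm) set \<Rightarrow> (real ^ 'l \<Rightarrow> real ^ 'm \<Rightarrow> real ^ 'l)
    \<Rightarrow> (real ^ 'l \<Rightarrow> real ^ 'm \<Rightarrow> real) \<Rightarrow> real
    \<Rightarrow> real \<Rightarrow> (real ^ 'l \<Rightarrow> real ^ 'l) \<Rightarrow> (real ^ 'l \<Rightarrow> real ^ 'm \<Rightarrow> real ^ 'l)
    \<Rightarrow> (nat \<Rightarrow> real ^ 'l \<Rightarrow> real ^ 'm) \<Rightarrow> (nat \<Rightarrow> real ^ 'l \<Rightarrow> real) \<Rightarrow> bool" where
  "IPI U f r \<gamma> \<eta> fd fc \<pi> v \<longleftrightarrow>
     0 < \<eta> \<and>
     continuous_on UNIV fd \<and> continuous_on (UNIV \<times> U) (\<lambda>(x, u). fc x u) \<and>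
     (\<forall>x. \<forall>u\<in>U. f x u = fd x + fc x u) \<and>
     admissible U f r \<gamma> (\<pi> 0) \<and>
     (\<forall>i\<ge>1.
        C1 (v i) \<and>
        (\<forall>x. v i x = discounted_reward f r \<gamma> (\<pi> (i - 1)) x \<eta>
                    + \<gamma> powr \<eta> * v i (state_under f (\<pi> (i - 1)) x \<eta>)) \<and>
        policy U (\<pi> i) \<and>
        (\<forall>x. is_arg_max (\<lambda>u. r x u + grad (v i) x \<bullet> fc x u) (\<lambda>u. u \<in> U) (\<pi> i x)))"

end

theory Submission
  imports Defs "HOL-Real_Asymp.Real_Asymp"
begin

text \<open>Evaluation and improvement are both read off the curve \<open>t \<mapsto> \<gamma>\<^sup>t v(X\<^sub>t)\<close>, whose
  derivative is \<open>\<gamma>\<^sup>t (h(X\<^sub>t, U\<^sub>t, \<nabla>v(X\<^sub>t)) - \<alpha> v(X\<^sub>t) - R\<^sub>t)\<close>.  Under the policy that was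
  evaluated it is \<open>-\<gamma>\<^sup>t R\<^sub>t\<close>, so integrating and letting \<open>t \<rightarrow> \<infinity>\<close> identifies \<open>v\<close> with the
  value function; under the improved policy it is at least \<open>-\<gamma>\<^sup>t R\<^sub>t\<close>, so the truncated
  return is at least \<open>v(x) - \<gamma>\<^sup>T v(X\<^sub>T)\<close>.  Boundedness of \<open>r\<close> from above bounds \<open>v\<close> from above
  and makes the compensated return \<open>\<integral>\<^sub>0\<^sup>T \<gamma>\<^sup>t R\<^sub>t dt + \<gamma>\<^sup>T r\<^sub>m\<^sub>a\<^sub>x / \<alpha>\<close> nonincreasing in \<open>T\<close>, which
  yields convergence, hence admissibility.  For integral policy iteration the fixed-horizon equation is
  iterated along \<open>T = n \<eta>\<close>; once \<open>v\<close> is known to be a value function it satisfies the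
  fixed-horizon equation for every horizon, and differentiating at horizon \<open>0\<close> gives the
  differential equation.\<close>

section \<open>Preliminaries on monotone functions, limits and gradients\<close>

text \<open>Trajectories are differentiated within \<open>{0..}\<close>, hence only one-sidedly at
  time 0. At interior points the derivative is two-sided; at the endpoints continuity
  suffices.\<close>

lemma mono_of_nonneg_derivative_atLeast:
  fixes g :: "real \<Rightarrow> real"
  assumes der: "\<And>t. t \<ge> 0 \<Longrightarrow> (g has_real_derivative g' t) (at t within {0..})"
    and nonneg: "\<And>t. t \<ge> 0 \<Longrightarrow> g' t \<ge> 0"
    and st: "0 \<le> s" "s \<le> t"
  shows "g s \<le> g t"
proof (rule DERIV_nonneg_imp_increasing_open[OF st(2)])
  fix y assume y: "s < y" "y < t"
  with st have "y \<in> interior {0..}" by (simp add: interior_real_atLeast)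
  then have "at y within {0..} = at y" by (rule at_within_interior)
  then show "\<exists>z. (g has_real_derivative z) (at y) \<and> z \<ge> 0"
    using der[of y] nonneg[of y] y st by (intro exI[of _ "g' y"]) simp
next
  have "continuous_on {0..} g"
    unfolding continuous_on_eq_continuous_within by (auto intro: DERIV_continuous[OF der])
  then show "continuous_on {s..t} g"
    by (rule continuous_on_subset) (use st in auto)
qed

lemma antimono_tendsto_at_top:
  fixes g :: "real \<Rightarrow> real"
  assumes anti: "\<And>s t. 0 \<le> s \<Longrightarrow> s \<le> t \<Longrightarrow> g t \<le> g s"
    and lower: "\<And>t. t \<ge> 0 \<Longrightarrow> c \<le> g t"
  shows "\<exists>L. (g \<longlongrightarrow> L) at_top \<and> c \<le> L"
proof -
  define L where "L = (INF t\<in>{0..}. g t)"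
  have bdd: "bdd_below (g ` {0..})" using lower by (auto intro!: bdd_belowI)
  have "c \<le> L" unfolding L_def by (rule cINF_greatest) (use lower in auto)
  moreover have "(g \<longlongrightarrow> L) at_top"
  proof (rule order_tendstoI)
    fix a assume "a < L"
    then have "a < g t" if "t \<ge> 0" for t
      using cINF_lower[OF bdd, of t] that by (simp add: L_def)
    then show "\<forall>\<^sub>F t in at_top. a < g t"
      using eventually_at_top_linorder by blast
  next
    fix a assume "L < a"
    then obtain s where s: "s \<ge> 0" "g s < a"
      unfolding L_def by (subst (asm) cINF_less_iff[OF _ bdd]) auto
    then have "g t < a" if "t \<ge> s" for t using anti[of s t] that by simp
    then show "\<forall>\<^sub>F t in at_top. g t < a"
      using eventually_at_top_linorder by blast
  qed
  ultimately show ?thesis by blast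
qed

text \<open>Justifies the \<open>THE\<close> in \<open>grad\<close>: the adjoint of the derivative,
  evaluated at 1, is the vector representing this linear functional, and uniqueness of derivatives
  makes it the only candidate.\<close>

lemma has_derivative_grad:
  assumes "v differentiable (at x)"
  shows "(v has_derivative (\<lambda>h. grad v x \<bullet> h)) (at x)"
proof -
  obtain v' where v': "(v has_derivative v') (at x)"
    using assms by (auto simp: differentiable_def)
  have "linear v'" using v' by (rule has_derivative_linear)
  define D where "D = adjoint v' 1"
  have "v' = (\<lambda>h. h \<bullet> D)"
    unfolding D_def by (rule ext) (simp only: adjoint_works[OF \<open>linear v'\<close>] inner_real_def mult_1_right)
  then have D: "GDERIV v x :> D" using v' by (simp add: gderiv_def)
  have "grad v x = D"
    unfolding grad_def
  proof (rule the_equality)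
    show "GDERIV v x :> D" by (rule D)
  next
    fix E assume "GDERIV v x :> E"
    then have "(\<lambda>h. h \<bullet> E) = (\<lambda>h. h \<bullet> D)"
      using D unfolding gderiv_def by (rule has_derivative_unique)
    then have "\<forall>h. h \<bullet> E = h \<bullet> D" by (intro allI) (rule fun_cong)
    then show "E = D" by (rule vector_eq_ldot[THEN iffD1])
  qed
  then show ?thesis using D by (simp add: gderiv_def inner_commute)
qed

lemma value_function_eqI:
  assumes "(discounted_reward f r \<gamma> \<pi> x \<longlongrightarrow> L) at_top"
  shows "value_function f r \<gamma> \<pi> x = ereal L"
  unfolding value_function_def
  by (rule tendsto_Lim[OF trivial_limit_at_top_linorder tendsto_ereal[OF assms]])

context rl_problem
begin

section \<open>Discounting and the upper bound on returns\<close>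

lemma discount_powr_has_derivative:
  "((\<lambda>t. \<gamma> powr t) has_real_derivative \<gamma> powr t * ln \<gamma>) (at t within S)"
  using discount by (auto simp: powr_def intro!: derivative_eq_intros)

text \<open>The junk value \<open>x / 0 = 0\<close> makes this the correct bound \<open>0\<close> when \<open>\<gamma> = 1\<close>.\<close>

definition return_bound :: real where
  "return_bound = (SUP (x, u) \<in> UNIV \<times> U. r x u) / (- ln \<gamma>)"

lemma reward_le: "u \<in> U \<Longrightarrow> r x u \<le> return_bound * (- ln \<gamma>)"
proof -
  assume u: "u \<in> U"
  obtain m y w where m: "w \<in> U" "r y w = m" "\<And>x u. u \<in> U \<Longrightarrow> r x u \<le> m" "\<gamma> = 1 \<longrightarrow> m = 0"
    using r_max by blast
  have "(SUP (x, u) \<in> UNIV \<times> U. r x u) = m"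
  proof (rule cSup_eq_maximum)
    have "(\<lambda>(x, u). r x u) (y, w) \<in> (\<lambda>(x, u). r x u) ` (UNIV \<times> U)"
      using m(1) by blast
    then show "m \<in> (\<lambda>(x, u). r x u) ` (UNIV \<times> U)" using m(2) by simp
  qed (use m(3) in auto)
  \<comment> \<open>For \<gamma> = 1 both sides are 0, because then \<open>m = 0\<close>; otherwise
    the logarithm is nonzero and cancels.\<close>
  then have "return_bound * (- ln \<gamma>) = m"
    using m(4) discount by (auto simp: return_bound_def)
  then show ?thesis using m(3) u by simp
qed

text \<open>For \<gamma> < 1 the power decays; for \<gamma> = 1 it does not, but then the bound
  itself is 0.\<close>

lemma return_bound_vanishes: "((\<lambda>t. \<gamma> powr t * return_bound) \<longlongrightarrow> 0) at_top"
proof (cases "\<gamma> = 1")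
  case True
  then have "return_bound = 0" unfolding return_bound_def by simp
  then show ?thesis by simp
next
  case False
  have "((\<lambda>t. \<gamma> powr t) \<longlongrightarrow> 0) at_top"
    using discount False by real_asymp
  then show ?thesis by (rule tendsto_mult_left_zero)
qed

section \<open>Closed-loop trajectories and truncated returns\<close>

lemma policy_in: "policy U \<pi> \<Longrightarrow> \<pi> x \<in> U"
  by (auto simp: policy_def)

lemma state_under_trajectory:
  assumes "policy U \<pi>"
  shows "closed_loop_trajectory f \<pi> x (state_under f \<pi> x)"
proof -
  have "\<exists>X. closed_loop_trajectory f \<pi> x X"
    using trajectory_closed_loop[OF assms, of x] unfolding uniquely_defined_def by blast
  then show ?thesis unfolding state_under_def by (rule someI_ex)
qed

lemma state_under_0: "policy U \<pi> \<Longrightarrow> state_under f \<pi> x 0 = x"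
  using state_under_trajectory by (auto simp: closed_loop_trajectory_def state_trajectory_def)

lemma state_under_has_derivative:
  "policy U \<pi> \<Longrightarrow> t \<ge> 0 \<Longrightarrow> (state_under f \<pi> x has_vector_derivative
     f (state_under f \<pi> x t) (\<pi> (state_under f \<pi> x t))) (at t within {0..})"
  using state_under_trajectory by (auto simp: closed_loop_trajectory_def state_trajectory_def)

lemma continuous_on_state_under: "policy U \<pi> \<Longrightarrow> continuous_on {0..} (state_under f \<pi> x)"
  unfolding continuous_on_eq_continuous_within
  by (auto intro: has_vector_derivative_continuous state_under_has_derivative)

text \<open>Semigroup property: the closed-loop equation is autonomous, so the trajectory shifted by
  \<open>s\<close> solves it from the state reached at time \<open>s\<close>, and uniqueness
  identifies the two.\<close>

lemma state_under_add:
  assumes \<pi>: "policy U \<pi>" and s: "s \<ge> 0" and t: "t \<ge> 0"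
  shows "state_under f \<pi> x (s + t) = state_under f \<pi> (state_under f \<pi> x s) t"
proof -
  let ?X = "state_under f \<pi> x"
  have "closed_loop_trajectory f \<pi> (?X s) (\<lambda>t. ?X (s + t))"
    unfolding closed_loop_trajectory_def state_trajectory_def
  proof (intro conjI allI impI)
    fix t :: real assume t: "t \<ge> 0"
    have "(?X has_vector_derivative f (?X (s + t)) (\<pi> (?X (s + t)))) (at (s + t) within (+) s ` {0..})"
      by (rule has_vector_derivative_within_subset[OF state_under_has_derivative[OF \<pi>]])
        (use s t in auto)
    moreover have "((+) s has_vector_derivative 1) (at t within {0..})"
      by (auto intro!: derivative_eq_intros simp: has_vector_derivative_def)
    ultimately show "((\<lambda>t. ?X (s + t)) has_vector_derivative f (?X (s + t)) (\<pi> (?X (s + t))))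
        (at t within {0..})"
      using vector_diff_chain_within[of "(+) s" 1 t "{0..}" ?X] by (simp add: o_def)
  qed simp
  then show ?thesis
    using trajectory_closed_loop[OF \<pi>, of "?X s"] state_under_trajectory[OF \<pi>, of "?X s"] t
    unfolding uniquely_defined_def by blast
qed

lemma continuous_on_reward:
  assumes \<pi>: "policy U \<pi>"
  shows "continuous_on {0..} (\<lambda>t. \<gamma> powr t * r (state_under f \<pi> x t) (\<pi> (state_under f \<pi> x t)))"
proof -
  have "continuous_on {0..} (\<lambda>t. \<pi> (state_under f \<pi> x t))"
    by (rule continuous_on_compose2[OF _ continuous_on_state_under[OF \<pi>]])
      (use \<pi> in \<open>auto simp: policy_def\<close>)
  then have "continuous_on {0..} (\<lambda>t. (\<lambda>(x, u). r x u) (state_under f \<pi> x t, \<pi> (state_under f \<pi> x t)))"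
    using \<pi> by (intro continuous_on_compose2[OF r_continuous] continuous_on_Pair
        continuous_on_state_under) (auto simp: policy_def)
  then show ?thesis
    using discount by (auto intro!: continuous_intros)
qed

lemma discounted_reward_0 [simp]: "discounted_reward f r \<gamma> \<pi> x 0 = 0"
  by (simp add: discounted_reward_def)

lemma discounted_reward_has_derivative:
  assumes \<pi>: "policy U \<pi>" and t: "t \<ge> 0"
  shows "(discounted_reward f r \<gamma> \<pi> x has_real_derivative
           \<gamma> powr t * r (state_under f \<pi> x t) (\<pi> (state_under f \<pi> x t))) (at t within {0..})"
proof -
  have "(discounted_reward f r \<gamma> \<pi> x has_real_derivative
           \<gamma> powr t * r (state_under f \<pi> x t) (\<pi> (state_under f \<pi> x t))) (at t within {0..t+1})"
    unfolding discounted_reward_def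
    by (rule integral_has_real_derivative[OF continuous_on_subset[OF continuous_on_reward[OF \<pi>]]])
      (use t in auto)
  \<comment> \<open>The integral is differentiated on a compact interval; ending it at
    \<open>t + 1\<close> keeps a full neighbourhood of \<open>t\<close> in
    \<open>{0..}\<close>.\<close>
  moreover have "at t within {0..t+1} = at t within {0..}"
    by (rule at_within_nhd[of t "{..<t+1}"]) auto
  ultimately show ?thesis by simp
qed

text \<open>Split the integral at \<open>s\<close> and shift time: by the semigroup property the
  remaining rewards are those of a fresh start, discounted by the extra factor
  \<open>\<gamma> powr s\<close>.\<close>

lemma discounted_reward_add:
  assumes \<pi>: "policy U \<pi>" and s: "s \<ge> 0" and t: "t \<ge> 0"
  shows "discounted_reward f r \<gamma> \<pi> x (s + t) =
    discounted_reward f r \<gamma> \<pi> x s + \<gamma> powr s * discounted_reward f r \<gamma> \<pi> (state_under f \<pi> x s) t"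
proof -
  let ?g = "\<lambda>x t. \<gamma> powr t * r (state_under f \<pi> x t) (\<pi> (state_under f \<pi> x t))"
  have cont: "continuous_on {a..b} (?g x)" if "a \<ge> 0" for a b
    using continuous_on_reward[OF \<pi>] by (rule continuous_on_subset) (use that in auto)
  have "integral {0..s+t} (?g x) = integral {0..s} (?g x) + integral {s..s+t} (?g x)"
    using s t by (intro Henstock_Kurzweil_Integration.integral_combine[symmetric]
        integrable_continuous_real cont) auto
  also have "integral {s..s+t} (?g x) = integral {0..t} (?g x \<circ> (\<lambda>\<tau>. \<tau> + s))"
    using integral_shift[of 0 s t "?g x"] cont[of s "s + t"] s by (simp add: add.commute)
  also have "\<dots> = integral {0..t} (\<lambda>\<tau>. \<gamma> powr s * ?g (state_under f \<pi> x s) \<tau>)"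
  proof (rule integral_cong)
    fix \<tau> assume "\<tau> \<in> {0..t}"
    then show "(?g x \<circ> (\<lambda>\<tau>. \<tau> + s)) \<tau> = \<gamma> powr s * ?g (state_under f \<pi> x s) \<tau>"
      using state_under_add[OF \<pi> s, of \<tau> x] by (simp add: add.commute[of \<tau>] powr_add mult.assoc)
  qed
  finally show ?thesis by (simp add: discounted_reward_def)
qed

section \<open>Convergence of returns\<close>

text \<open>The added term is the discounted value of earning the maximal reward from then on. The
  sum is thus an upper bound on what is still attainable, and it can only shrink as actual rewards
  replace maximal ones.\<close>

lemma compensated_return_antimono:
  assumes \<pi>: "policy U \<pi>" and st: "0 \<le> s" "s \<le> t"
  shows "discounted_reward f r \<gamma> \<pi> x t + \<gamma> powr t * return_bound
       \<le> discounted_reward f r \<gamma> \<pi> x s + \<gamma> powr s * return_bound"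
proof -
  let ?X = "state_under f \<pi> x"
  have "- (discounted_reward f r \<gamma> \<pi> x s + \<gamma> powr s * return_bound)
      \<le> - (discounted_reward f r \<gamma> \<pi> x t + \<gamma> powr t * return_bound)"
  proof (rule mono_of_nonneg_derivative_atLeast[OF _ _ st])
    fix t :: real assume t: "t \<ge> 0"
    show "((\<lambda>t. - (discounted_reward f r \<gamma> \<pi> x t + \<gamma> powr t * return_bound)) has_real_derivative
        \<gamma> powr t * (return_bound * (- ln \<gamma>) - r (?X t) (\<pi> (?X t)))) (at t within {0..})"
      using DERIV_minus[OF DERIV_add[OF discounted_reward_has_derivative[OF \<pi> t, of x]
          DERIV_cmult_right[OF discount_powr_has_derivative[of t "{0..}"], of return_bound]]]
      by (simp add: algebra_simps)
    show "\<gamma> powr t * (return_bound * (- ln \<gamma>) - r (?X t) (\<pi> (?X t))) \<ge> 0"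
      by (intro mult_nonneg_nonneg powr_ge_zero) (simp only: diff_ge_0_iff_ge reward_le policy_in[OF \<pi>])
  qed
  then show ?thesis by simp
qed

text \<open>A lower bound forces the nonincreasing compensated return to converge, and the
  compensation vanishes in the limit. This is how finiteness of a value is obtained without knowing
  it in advance.\<close>

lemma discounted_reward_tendsto:
  assumes \<pi>: "policy U \<pi>"
    and lower: "\<And>t. t \<ge> 0 \<Longrightarrow> c \<le> discounted_reward f r \<gamma> \<pi> x t + \<gamma> powr t * return_bound"
  shows "\<exists>L. (discounted_reward f r \<gamma> \<pi> x \<longlongrightarrow> L) at_top \<and> c \<le> L"
proof -
  have "\<exists>L. ((\<lambda>t. discounted_reward f r \<gamma> \<pi> x t + \<gamma> powr t * return_bound) \<longlongrightarrow> L) at_top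
      \<and> c \<le> L"
    by (rule antimono_tendsto_at_top) (fact compensated_return_antimono[OF \<pi>] lower)+
  then obtain L where L: "c \<le> L"
      "((\<lambda>t. discounted_reward f r \<gamma> \<pi> x t + \<gamma> powr t * return_bound) \<longlongrightarrow> L) at_top"
    by blast
  from tendsto_diff[OF L(2) return_bound_vanishes]
  have "(discounted_reward f r \<gamma> \<pi> x \<longlongrightarrow> L) at_top" by simp
  with L(1) show ?thesis by blast
qed

text \<open>The compensated return equals the bound at time 0, never increases, and has the same
  limit as the return.\<close>

lemma return_limit_le_bound:
  assumes \<pi>: "policy U \<pi>" and L: "(discounted_reward f r \<gamma> \<pi> x \<longlongrightarrow> L) at_top"
  shows "L \<le> return_bound"
proof -
  have "((\<lambda>t. discounted_reward f r \<gamma> \<pi> x t + \<gamma> powr t * return_bound) \<longlongrightarrow> L) at_top"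
    using tendsto_add[OF L return_bound_vanishes] by simp
  then show ?thesis
  proof (rule tendsto_upperbound)
    show "\<forall>\<^sub>F t in at_top. discounted_reward f r \<gamma> \<pi> x t + \<gamma> powr t * return_bound \<le> return_bound"
      using eventually_ge_at_top[of 0]
      by eventually_elim (use compensated_return_antimono[OF \<pi>, of 0] discount in auto)
  qed simp
qed

section \<open>The discounted value along a trajectory\<close>

lemma discounted_value_has_derivative:
  assumes \<pi>: "policy U \<pi>" and t: "t \<ge> 0" and v: "v differentiable (at (state_under f \<pi> x t))"
  shows "((\<lambda>t. \<gamma> powr t * v (state_under f \<pi> x t)) has_real_derivative
     \<gamma> powr t * (ln \<gamma> * v (state_under f \<pi> x t)
       + grad v (state_under f \<pi> x t) \<bullet> f (state_under f \<pi> x t) (\<pi> (state_under f \<pi> x t))))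
     (at t within {0..})"
proof -
  let ?X = "state_under f \<pi> x"
  have "(v has_derivative (\<lambda>h. grad v (?X t) \<bullet> h)) (at (?X t) within ?X ` {0..})"
    by (rule has_derivative_at_withinI[OF has_derivative_grad[OF v]])
  from vector_derivative_diff_chain_within[OF state_under_has_derivative[OF \<pi> t] this]
  have "((\<lambda>t. v (?X t)) has_real_derivative grad v (?X t) \<bullet> f (?X t) (\<pi> (?X t))) (at t within {0..})"
    by (simp add: o_def has_real_derivative_iff_has_vector_derivative)
  from DERIV_mult[OF discount_powr_has_derivative this] show ?thesis
    by (simp add: algebra_simps)
qed

text \<open>The right-hand side equals \<open>v x\<close> at \<open>T = 0\<close>, and its
  derivative is the discounted slack of \<open>ineq\<close> at the current state. The one-sided
  hypothesis lets this serve both the evaluated and the improved policy.\<close>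

lemma truncated_return_ge:
  assumes \<pi>: "policy U \<pi>" and v: "\<And>x. v differentiable (at x)"
    and ineq: "\<And>x. - ln \<gamma> * v x \<le> hamiltonian f r x (\<pi> x) (grad v x)"
    and T: "T \<ge> 0"
  shows "v x \<le> discounted_reward f r \<gamma> \<pi> x T + \<gamma> powr T * v (state_under f \<pi> x T)"
proof -
  let ?X = "state_under f \<pi> x"
  let ?g = "\<lambda>t. discounted_reward f r \<gamma> \<pi> x t + \<gamma> powr t * v (?X t)"
  have "?g 0 \<le> ?g T"
  proof (rule mono_of_nonneg_derivative_atLeast[OF _ _ order_refl T])
    fix t :: real assume t: "t \<ge> 0"
    show "(?g has_real_derivative
        \<gamma> powr t * (hamiltonian f r (?X t) (\<pi> (?X t)) (grad v (?X t)) - (- ln \<gamma> * v (?X t))))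
        (at t within {0..})"
      using DERIV_add[OF discounted_reward_has_derivative[OF \<pi> t]
          discounted_value_has_derivative[OF \<pi> t v]]
      by (simp add: hamiltonian_def algebra_simps)
    show "\<gamma> powr t * (hamiltonian f r (?X t) (\<pi> (?X t)) (grad v (?X t)) - (- ln \<gamma> * v (?X t))) \<ge> 0"
      using ineq[of "?X t"] by (intro mult_nonneg_nonneg) auto
  qed
  then show ?thesis using discount by (simp add: state_under_0[OF \<pi>])
qed

lemma truncated_return_le:
  assumes \<pi>: "policy U \<pi>" and v: "\<And>x. v differentiable (at x)"
    and ineq: "\<And>x. hamiltonian f r x (\<pi> x) (grad v x) \<le> - ln \<gamma> * v x"
    and T: "T \<ge> 0"
  shows "discounted_reward f r \<gamma> \<pi> x T + \<gamma> powr T * v (state_under f \<pi> x T) \<le> v x"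
proof -
  let ?X = "state_under f \<pi> x"
  let ?g = "\<lambda>t. - (discounted_reward f r \<gamma> \<pi> x t + \<gamma> powr t * v (?X t))"
  have "?g 0 \<le> ?g T"
  proof (rule mono_of_nonneg_derivative_atLeast[OF _ _ order_refl T])
    fix t :: real assume t: "t \<ge> 0"
    show "(?g has_real_derivative
        \<gamma> powr t * (- ln \<gamma> * v (?X t) - hamiltonian f r (?X t) (\<pi> (?X t)) (grad v (?X t))))
        (at t within {0..})"
      using DERIV_minus[OF DERIV_add[OF discounted_reward_has_derivative[OF \<pi> t]
          discounted_value_has_derivative[OF \<pi> t v]]]
      by (simp add: hamiltonian_def algebra_simps)
    show "\<gamma> powr t * (- ln \<gamma> * v (?X t) - hamiltonian f r (?X t) (\<pi> (?X t)) (grad v (?X t))) \<ge> 0"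
      using ineq[of "?X t"] by (intro mult_nonneg_nonneg) auto
  qed
  then show ?thesis using discount by (simp add: state_under_0[OF \<pi>])
qed

section \<open>Policy evaluation\<close>

text \<open>With equality in the Hamiltonian condition the two truncated bounds coincide, so the
  return up to \<open>t\<close> differs from \<open>v x\<close> only by the boundary term.\<close>

lemma differential_evaluation:
  assumes \<pi>: "policy U \<pi>" and v: "\<And>x. v differentiable (at x)"
    and bellman: "\<And>x. - ln \<gamma> * v x = hamiltonian f r x (\<pi> x) (grad v x)"
    and boundary: "((\<lambda>t. \<gamma> powr t * v (state_under f \<pi> x t)) \<longlongrightarrow> 0) at_top"
  shows "(discounted_reward f r \<gamma> \<pi> x \<longlongrightarrow> v x) at_top"
proof -
  have "((\<lambda>t. v x - \<gamma> powr t * v (state_under f \<pi> x t)) \<longlongrightarrow> v x) at_top"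
    using tendsto_diff[OF tendsto_const boundary, of "v x"] by simp
  moreover have "\<forall>\<^sub>F t in at_top. v x - \<gamma> powr t * v (state_under f \<pi> x t)
      = discounted_reward f r \<gamma> \<pi> x t"
    using eventually_ge_at_top[of 0]
  proof eventually_elim
    case (elim t)
    then have "v x = discounted_reward f r \<gamma> \<pi> x t + \<gamma> powr t * v (state_under f \<pi> x t)"
      by (intro order_antisym truncated_return_ge[OF \<pi> v eq_refl[OF bellman]]
          truncated_return_le[OF \<pi> v eq_refl[OF bellman[symmetric]]])
    then show ?case by linarith
  qed
  ultimately show ?thesis by (rule Lim_transform_eventually)
qed

text \<open>The equation controls the return only at multiples of \<eta>, which gives a limit along
  a sequence. Monotonicity of the compensated return extends it to all times.\<close>

lemma integral_evaluation:
  assumes \<pi>: "policy U \<pi>" and \<eta>: "\<eta> > 0"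
    and bellman: "\<And>x. v x = discounted_reward f r \<gamma> \<pi> x \<eta> + \<gamma> powr \<eta> * v (state_under f \<pi> x \<eta>)"
    and boundary: "((\<lambda>t. \<gamma> powr t * v (state_under f \<pi> x t)) \<longlongrightarrow> 0) at_top"
  shows "(discounted_reward f r \<gamma> \<pi> x \<longlongrightarrow> v x) at_top"
proof -
  have iter: "v x = discounted_reward f r \<gamma> \<pi> x (real n * \<eta>)
      + \<gamma> powr (real n * \<eta>) * v (state_under f \<pi> x (real n * \<eta>))" for n
  proof (induction n)
    case 0
    show ?case using discount by (simp add: state_under_0[OF \<pi>])
  next
    case (Suc n)
    have n: "real n * \<eta> \<ge> 0" using \<eta> by simp
    let ?y = "state_under f \<pi> x (real n * \<eta>)"
    have "v x = discounted_reward f r \<gamma> \<pi> x (real n * \<eta>)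
        + \<gamma> powr (real n * \<eta>) * discounted_reward f r \<gamma> \<pi> ?y \<eta>
        + \<gamma> powr (real n * \<eta>) * \<gamma> powr \<eta> * v (state_under f \<pi> ?y \<eta>)"
      by (subst Suc, subst bellman[of ?y]) (simp only: distrib_left mult.assoc add.assoc)
    moreover have "real (Suc n) * \<eta> = real n * \<eta> + \<eta>" by (simp add: distrib_right)
    ultimately show ?case
      using \<eta> by (simp only: discounted_reward_add[OF \<pi> n] state_under_add[OF \<pi> n] powr_add less_imp_le)
  qed
  have steps: "filterlim (\<lambda>n. real n * \<eta>) at_top sequentially"
    using \<eta> by real_asymp
  have "discounted_reward f r \<gamma> \<pi> x (real n * \<eta>)
      = v x - \<gamma> powr (real n * \<eta>) * v (state_under f \<pi> x (real n * \<eta>))" for n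
    using iter[of n] by linarith
  then have lim: "(\<lambda>n. discounted_reward f r \<gamma> \<pi> x (real n * \<eta>)) \<longlonglongrightarrow> v x"
    using tendsto_diff[OF tendsto_const filterlim_compose[OF boundary steps], of "v x"] by simp
  from tendsto_add[OF this filterlim_compose[OF return_bound_vanishes steps]]
  have lim': "(\<lambda>n. discounted_reward f r \<gamma> \<pi> x (real n * \<eta>) + \<gamma> powr (real n * \<eta>) * return_bound)
      \<longlonglongrightarrow> v x" by simp
  \<comment> \<open>The compensated return at \<open>t\<close> dominates its values at all later
    grid times, hence their limit \<open>v x\<close>.\<close>
  have "v x \<le> discounted_reward f r \<gamma> \<pi> x t + \<gamma> powr t * return_bound" if "t \<ge> 0" for t
  proof (rule tendsto_upperbound[OF lim'])
    have "\<forall>\<^sub>F n in sequentially. t \<le> real n * \<eta>"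
      using steps by (simp add: filterlim_at_top)
    then show "\<forall>\<^sub>F n in sequentially. discounted_reward f r \<gamma> \<pi> x (real n * \<eta>)
        + \<gamma> powr (real n * \<eta>) * return_bound \<le> discounted_reward f r \<gamma> \<pi> x t + \<gamma> powr t * return_bound"
      by eventually_elim (rule compensated_return_antimono[OF \<pi> that])
  qed simp
  then obtain L where L: "(discounted_reward f r \<gamma> \<pi> x \<longlongrightarrow> L) at_top"
    using discounted_reward_tendsto[OF \<pi>] by blast
  \<comment> \<open>The full limit exists, so the grid sequence determines its value.\<close>
  then have "L = v x"
    using LIMSEQ_unique[OF filterlim_compose[OF L steps] lim] by simp
  with L show ?thesis by simp
qed

section \<open>From value functions to policy improvement\<close>

text \<open>Lets both schemes share one improvement argument: the differential equation is recovered
  from \<open>v\<close> being the limit of returns, however \<open>v\<close> was computed.\<close>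

lemma value_function_bellman:
  assumes \<pi>: "policy U \<pi>" and v: "\<And>x. v differentiable (at x)"
    and val: "\<And>x. (discounted_reward f r \<gamma> \<pi> x \<longlongrightarrow> v x) at_top"
  shows "- ln \<gamma> * v x = hamiltonian f r x (\<pi> x) (grad v x)"
proof -
  let ?X = "state_under f \<pi> x"
  let ?g = "\<lambda>t. discounted_reward f r \<gamma> \<pi> x t + \<gamma> powr t * v (?X t)"
  \<comment> \<open>The return up to \<open>T + t\<close> is sent to its limit in two ways:
    directly, and after splitting off the first \<open>T\<close> units of time.\<close>
  have const: "?g T = v x" if T: "T \<ge> 0" for T
  proof -
    have "((\<lambda>t. discounted_reward f r \<gamma> \<pi> x (T + t)) \<longlongrightarrow> v x) at_top"
      by (rule filterlim_compose[OF val]) (rule filterlim_tendsto_add_at_top[OF tendsto_const filterlim_ident])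
    moreover have "((\<lambda>t. discounted_reward f r \<gamma> \<pi> x (T + t)) \<longlongrightarrow> ?g T) at_top"
    proof (rule Lim_transform_eventually)
      show "((\<lambda>t. discounted_reward f r \<gamma> \<pi> x T + \<gamma> powr T * discounted_reward f r \<gamma> \<pi> (?X T) t)
          \<longlongrightarrow> ?g T) at_top"
        by (rule tendsto_add[OF tendsto_const tendsto_mult_left[OF val]])
      show "\<forall>\<^sub>F t in at_top. discounted_reward f r \<gamma> \<pi> x T
          + \<gamma> powr T * discounted_reward f r \<gamma> \<pi> (?X T) t = discounted_reward f r \<gamma> \<pi> x (T + t)"
        using eventually_ge_at_top[of 0]
        by eventually_elim (simp add: discounted_reward_add[OF \<pi> T])
    qed
    ultimately show ?thesis
      by (rule tendsto_unique[OF trivial_limit_at_top_linorder, symmetric])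
  qed
  \<comment> \<open>At time 0 the derivative of \<open>?g\<close> is exactly the defect of the
    differential equation at \<open>x\<close>; constancy of \<open>?g\<close> makes it 0.\<close>
  have "(?g has_real_derivative hamiltonian f r x (\<pi> x) (grad v x) - (- ln \<gamma> * v x)) (at 0 within {0..})"
    using DERIV_add[OF discounted_reward_has_derivative[OF \<pi> order_refl, of x]
        discounted_value_has_derivative[OF \<pi> order_refl v, of x]] discount
    by (simp add: hamiltonian_def state_under_0[OF \<pi>] algebra_simps)
  then have "((\<lambda>t. v x) has_real_derivative hamiltonian f r x (\<pi> x) (grad v x) - (- ln \<gamma> * v x))
      (at 0 within {0..})"
    by (rule has_field_derivative_transform_within[where d = 1]) (use const in auto)
  moreover have "((\<lambda>t::real. v x) has_real_derivative 0) (at 0 within {0..})"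
    by (rule DERIV_const)
  \<comment> \<open>One-sided derivatives are unique here because 0 is a limit point of
    \<open>{0..}\<close>.\<close>
  moreover have "at 0 within {0::real..} \<noteq> bot"
    by (simp add: at_within_Ici_at_right)
  ultimately have "hamiltonian f r x (\<pi> x) (grad v x) - (- ln \<gamma> * v x) = 0"
    by (rule has_field_derivative_unique)
  then show ?thesis by linarith
qed

text \<open>No boundary condition is assumed for \<open>v\<close> along the new policy. Instead,
  \<open>v\<close> is a limit of returns and so is at most \<open>return_bound\<close>, which turns
  the truncated inequality into the lower bound that convergence requires.\<close>

lemma policy_improvement:
  assumes \<pi>: "policy U \<pi>" and \<pi>': "policy U \<pi>'" and v: "\<And>x. v differentiable (at x)"
    and val: "\<And>x. (discounted_reward f r \<gamma> \<pi> x \<longlongrightarrow> v x) at_top"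
    and greedy: "\<And>x. is_arg_max (\<lambda>u. hamiltonian f r x u (grad v x)) (\<lambda>u. u \<in> U) (\<pi>' x)"
  shows "\<exists>L. (discounted_reward f r \<gamma> \<pi>' x \<longlongrightarrow> L) at_top \<and> v x \<le> L"
proof (rule discounted_reward_tendsto[OF \<pi>'])
  fix t :: real assume t: "t \<ge> 0"
  \<comment> \<open>The left side is the Hamiltonian at the old action, which competes in the
    maximization.\<close>
  have "- ln \<gamma> * v x \<le> hamiltonian f r x (\<pi>' x) (grad v x)" for x
    using greedy[of x] value_function_bellman[OF \<pi> v val, of x] \<pi>
    by (force simp: is_arg_max_linorder policy_def)
  then have "v x \<le> discounted_reward f r \<gamma> \<pi>' x t + \<gamma> powr t * v (state_under f \<pi>' x t)"
    using truncated_return_ge[OF \<pi>' v _ t] by blast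
  also have "\<dots> \<le> discounted_reward f r \<gamma> \<pi>' x t + \<gamma> powr t * return_bound"
    using return_limit_le_bound[OF \<pi> val] by (simp add: mult_left_mono)
  finally show "v x \<le> discounted_reward f r \<gamma> \<pi>' x t + \<gamma> powr t * return_bound" .
qed

end

section \<open>Induction along the iteration, for both schemes\<close>

theorem theorem4p1:
  fixes U :: "(real ^ 'm) set"
    and f :: "real ^ 'l \<Rightarrow> real ^ 'm \<Rightarrow> real ^ 'l"
    and r :: "real ^ 'l \<Rightarrow> real ^ 'm \<Rightarrow> real"
    and \<gamma> :: real
    and \<pi> :: "nat \<Rightarrow> real ^ 'l \<Rightarrow> real ^ 'm"
    and v :: "nat \<Rightarrow> real ^ 'l \<Rightarrow> real"
  assumes "rl_problem U f r \<gamma>"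
    and "DPI U f r \<gamma> \<pi> v \<or> (\<exists>\<eta> fd fc. IPI U f r \<gamma> \<eta> fd fc \<pi> v)"
    and "\<And>i x. i \<ge> 1 \<Longrightarrow> admissible U f r \<gamma> (\<pi> (i - 1)) \<Longrightarrow>
           ((\<lambda>t. \<gamma> powr t * v i (state_under f (\<pi> (i - 1)) x t)) \<longlongrightarrow> 0) at_top"
  shows "(\<forall>i\<ge>1. admissible U f r \<gamma> (\<pi> (i - 1)) \<and>
            (\<forall>x. value_function f r \<gamma> (\<pi> (i - 1)) x = ereal (v i x)))
       \<and> (\<forall>i\<ge>1. policy_le f r \<gamma> (\<pi> (i - 1)) (\<pi> i))"
proof -
  interpret rl_problem U f r \<gamma> by fact
  \<comment> \<open>What the improvement argument needs, extracted from either scheme. Admissibility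
    stays a premise of the convergence claim because the boundary condition is granted only under
    it.\<close>
  have step: "policy U (\<pi> (i - 1)) \<and> policy U (\<pi> i) \<and> (\<forall>x. v i differentiable (at x)) \<and>
      (\<forall>x. is_arg_max (\<lambda>u. hamiltonian f r x u (grad (v i) x)) (\<lambda>u. u \<in> U) (\<pi> i x)) \<and>
      (admissible U f r \<gamma> (\<pi> (i - 1)) \<longrightarrow>
        (\<forall>x. (discounted_reward f r \<gamma> (\<pi> (i - 1)) x \<longlongrightarrow> v i x) at_top))" if i: "i \<ge> 1" for i
    using assms(2)
  proof (elim disjE exE)
    assume dpi: "DPI U f r \<gamma> \<pi> v"
    then have pol: "policy U (\<pi> j)" for j
      by (cases j) (auto simp: DPI_def admissible_def)
    have v: "\<And>x. v i differentiable (at x)"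
      and bellman: "\<And>x. - ln \<gamma> * v i x = hamiltonian f r x (\<pi> (i - 1) x) (grad (v i) x)"
      and greedy: "\<And>x. is_arg_max (\<lambda>u. hamiltonian f r x u (grad (v i) x)) (\<lambda>u. u \<in> U) (\<pi> i x)"
      using dpi i by (auto simp: DPI_def C1_def)
    show ?thesis
      by (intro conjI allI impI pol v greedy differential_evaluation[OF pol v bellman] assms(3)[OF i])
  next
    fix \<eta> fd fc assume ipi: "IPI U f r \<gamma> \<eta> fd fc \<pi> v"
    then have pol: "policy U (\<pi> j)" for j
      by (cases j) (auto simp: IPI_def admissible_def)
    have \<eta>: "\<eta> > 0" and split: "\<And>x u. u \<in> U \<Longrightarrow> f x u = fd x + fc x u"
      using ipi by (simp_all add: IPI_def)
    have "C1 (v i)"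
      and bellman: "\<And>x. v i x = discounted_reward f r \<gamma> (\<pi> (i - 1)) x \<eta>
          + \<gamma> powr \<eta> * v i (state_under f (\<pi> (i - 1)) x \<eta>)"
      and greedy: "\<And>x. is_arg_max (\<lambda>u. r x u + grad (v i) x \<bullet> fc x u) (\<lambda>u. u \<in> U) (\<pi> i x)"
      using ipi i unfolding IPI_def by blast+
    then have v: "\<And>x. v i differentiable (at x)" by (simp add: C1_def)
    \<comment> \<open>On \<open>U\<close> the two objectives differ by the inner product of the
      gradient with \<open>fd x\<close>, which is constant in \<open>u\<close>, so they have the
      same maximizers.\<close>
    have greedy': "is_arg_max (\<lambda>u. hamiltonian f r x u (grad (v i) x)) (\<lambda>u. u \<in> U) (\<pi> i x)" for x
      using greedy[of x] by (auto simp: is_arg_max_linorder hamiltonian_def split inner_add_right)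
    show ?thesis
      by (intro conjI allI impI pol v greedy' integral_evaluation[OF pol \<eta> bellman] assms(3)[OF i])
  qed
  \<comment> \<open>One round carries admissibility from \<open>\<pi> (i - 1)\<close> to
    \<open>\<pi> i\<close>: the limit of returns exists as a real number at every state.\<close>
  have improve: "admissible U f r \<gamma> (\<pi> i) \<and> policy_le f r \<gamma> (\<pi> (i - 1)) (\<pi> i)
      \<and> (\<forall>x. value_function f r \<gamma> (\<pi> (i - 1)) x = ereal (v i x))"
    if i: "i \<ge> 1" and adm: "admissible U f r \<gamma> (\<pi> (i - 1))" for i
  proof -
    note step_i = step[OF i]
    from step_i adm have val: "\<And>x. (discounted_reward f r \<gamma> (\<pi> (i - 1)) x \<longlongrightarrow> v i x) at_top"
      by simp
    then have eq: "value_function f r \<gamma> (\<pi> (i - 1)) x = ereal (v i x)" for x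
      by (rule value_function_eqI)
    have "\<exists>L. (discounted_reward f r \<gamma> (\<pi> i) x \<longlongrightarrow> L) at_top \<and> v i x \<le> L" for x
      by (rule policy_improvement[of "\<pi> (i - 1)" "\<pi> i" "v i" x]) (use step_i val in simp_all)
    then have "\<exists>L. value_function f r \<gamma> (\<pi> i) x = ereal L \<and> v i x \<le> L" for x
      by (blast intro: value_function_eqI)
    then obtain L where L: "\<And>x. value_function f r \<gamma> (\<pi> i) x = ereal (L x)" "\<And>x. v i x \<le> L x"
      by metis
    show ?thesis
      using step_i L(2) by (simp add: admissible_def policy_le_def L(1) eq del: One_nat_def)
  qed
  have adm: "admissible U f r \<gamma> (\<pi> i)" for i
  proof (induction i)
    case 0
    then show ?case using assms(2) by (auto simp: DPI_def IPI_def)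
  next
    case (Suc i)
    \<comment> \<open>Rounds are numbered from 1, so the step from \<open>\<pi> i\<close> to the
      next policy is round \<open>Suc i\<close>.\<close>
    then show ?case using improve[of "Suc i"] by simp
  qed
  then show ?thesis using improve by blast
qed

end
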